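(* Let $(\overline{M}^{n+k},\overline{g})$ be a semi-Riemannian manifold and let $(M^n,g)$ be a coisotropic $r$-null submanifold of $\overline{M}$, with $g$ the (degenerate) symmetric bilinear form induced by $\overline{g}$ on $M$. Fix a screen distribution on $M$, a local frame $\{\xi_1,\dots,\xi_r\}$ of the radical distribution over an open set $\mathcal{U}\subseteq M$, and corresponding null transversal sections $N_1,\dots,N_r$ over $\mathcal{U}$. Put $\omega_i(X)=\overline{g}(X,N_i)$ for $X$ tangent to $M$. Then the symmetric bilinear form $$\widetilde{g}=g-\sum_{i=1}^r\omega_i\otimes\omega_i$$ is nondegenerate on $T_xM$ for every $x\in\mathcal{U}$.
   Context: Let $M$ be an $n$-dimensional submanifold of an $(n+k)$-dimensional semi-Riemannian manifold $(\overline{M},\overline{g})$ of constant index $q\in\{1,\dots,n+k-1\}$, with $n>1$, $k\ge 1$, and let $g$ be the restriction of $\overline{g}$ to $TM$. The radical distribution is $Rad(TM)=TM\cap TM^{\perp}$, where $TM^\perp$ is the $\overline{g}$-orthogonal of $TM$ in $T\overline{M}|_M$. The submanifold $M$ is called $r$-null if $Rad(TM)$ is a smooth distribution of constant rank $r>0$. It is coisotropic if $r=k<n$ (equivalently $Rad(TM)=TM^\perp$ and $r<n$). A screen distribution $\mathcal{S}(TM)$ is a distribution complementary (and hence orthogonal) to $Rad(TM)$ in $TM$; it is nondegenerate for $g$. Given a local frame $\{\xi_1,\dots,\xi_r\}$ of $Rad(TM)$ over $\mathcal{U}$, the corresponding null transversal sections $N_1,\dots,N_r$ are sections over $\mathcal{U}$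 of the orthogonal complement $\mathcal{S}(TM)^\perp$ of $\mathcal{S}(TM)$ in $T\overline{M}|_M$ satisfying $\overline{g}(N_i,\xi_j)=\delta_{ij}$ and $\overline{g}(N_i,N_j)=0$ for all $i,j\in\{1,\dots,r\}$. In particular each $\omega_i$ vanishes on $\mathcal{S}(TM)$ and $\omega_i(\xi_j)=\delta_{ij}$. *)

theory Defs
  imports "HOL-Analysis.Analysis" "HOL-Library.Function_Algebras"
begin

text \<open>Real-valued functions on any set form a real vector space; this makes \<^const>\<open>subspace\<close>,
  \<^const>\<open>span\<close>, \<^const>\<open>independent\<close> and \<^const>\<open>dim\<close> available for
  tangent vectors, which are functionals on smooth functions.\<close>

instantiation "fun" :: (type, real_vector) real_vector
begin

definition scaleR_fun :: "real \<Rightarrow> ('a \<Rightarrow> 'b) \<Rightarrow> 'a \<Rightarrow> 'b" where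
  "scaleR_fun c f = (\<lambda>x. c *\<^sub>R f x)"

instance
  by standard (simp_all add: scaleR_fun_def fun_eq_iff scaleR_add_right scaleR_add_left)

end

section \<open>Smooth manifolds\<close>

text \<open>Both notions are intended for open \<open>S\<close> in a finite-dimensional space, where the
  second one is \<open>C\<^sup>\<infinity>\<close>.\<close>

primrec Ck_on :: "nat \<Rightarrow> 'a::real_normed_vector set \<Rightarrow> ('a \<Rightarrow> 'b::real_normed_vector) \<Rightarrow> bool" where
  "Ck_on 0 S f \<longleftrightarrow> continuous_on S f"
| "Ck_on (Suc k) S f \<longleftrightarrow>
     f differentiable_on S \<and> (\<forall>v. Ck_on k S (\<lambda>x. frechet_derivative f (at x) v))"

definition smooth_on :: "'a::real_normed_vector set \<Rightarrow> ('a \<Rightarrow> 'b::real_normed_vector) \<Rightarrow> bool" where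
  "smooth_on S f \<longleftrightarrow> (\<forall>k. Ck_on k S f)"

text \<open>The dimension of a manifold is \<open>DIM('e)\<close>. The topology is part of the data, so that
  a subset of a manifold can carry a manifold structure of its own.\<close>

record ('a, 'e) mfd =
  mtop :: "'a topology"
  charts :: "('a set \<times> ('a \<Rightarrow> 'e)) set"

abbreviation points :: "('a, 'e) mfd \<Rightarrow> 'a set" where
  "points M \<equiv> topspace (mtop M)"

definition smooth_manifold :: "('a, 'e::euclidean_space) mfd \<Rightarrow> bool" where
  "smooth_manifold M \<longleftrightarrow>
     Hausdorff_space (mtop M) \<and> second_countable (mtop M) \<and>
     (\<forall>(U, \<phi>) \<in> charts M. openin (mtop M) U \<and> open (\<phi> ` U) \<and>
        homeomorphic_map (subtopology (mtop M) U) (top_of_set (\<phi> ` U)) \<phi>) \<and>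
     (\<Union>(U, \<phi>) \<in> charts M. U) = points M \<and>
     (\<forall>(U, \<phi>) \<in> charts M. \<forall>(V, \<psi>) \<in> charts M. smooth_on (\<phi> ` (U \<inter> V)) (\<psi> \<circ> inv_into U \<phi>))"

definition smooth_fun_on :: "('a, 'e::euclidean_space) mfd \<Rightarrow> 'a set \<Rightarrow> ('a \<Rightarrow> real) \<Rightarrow> bool" where
  "smooth_fun_on M W f \<longleftrightarrow> openin (mtop M) W \<and>
     (\<forall>(U, \<phi>) \<in> charts M. smooth_on (\<phi> ` (U \<inter> W)) (f \<circ> inv_into U \<phi>))"

text \<open>The algebra of smooth functions on the whole manifold; functions are normalised to vanish
  off the manifold.\<close>

definition smooth_functions :: "('a, 'e::euclidean_space) mfd \<Rightarrow> ('a \<Rightarrow> real) set" where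
  "smooth_functions M = {f. smooth_fun_on M (points M) f \<and> (\<forall>x. x \<notin> points M \<longrightarrow> f x = 0)}"

definition smooth_map ::
  "('a, 'e::euclidean_space) mfd \<Rightarrow> ('b, 'f::euclidean_space) mfd \<Rightarrow> ('a \<Rightarrow> 'b) \<Rightarrow> bool" where
  "smooth_map M N F \<longleftrightarrow> continuous_map (mtop M) (mtop N) F \<and>
     (\<forall>(U, \<phi>) \<in> charts M. \<forall>(V, \<psi>) \<in> charts N.
        smooth_on (\<phi> ` (U \<inter> F -` V)) (\<psi> \<circ> F \<circ> inv_into U \<phi>))"

section \<open>Tangent vectors and sections\<close>

type_synonym 'a tvec = "('a \<Rightarrow> real) \<Rightarrow> real"

text \<open>Tangent vectors at \<open>p\<close> are the derivations at \<open>p\<close> of the algebra of smooth functions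
  (extended by 0 to functions that are not smooth).\<close>

definition tangent_space :: "('a, 'e::euclidean_space) mfd \<Rightarrow> 'a \<Rightarrow> 'a tvec set" where
  "tangent_space M p = {D.
     (\<forall>f \<in> smooth_functions M. \<forall>h \<in> smooth_functions M. D (\<lambda>x. f x + h x) = D f + D h) \<and>
     (\<forall>f \<in> smooth_functions M. \<forall>c. D (\<lambda>x. c * f x) = c * D f) \<and>
     (\<forall>f \<in> smooth_functions M. \<forall>h \<in> smooth_functions M.
        D (\<lambda>x. f x * h x) = f p * D h + h p * D f) \<and>
     (\<forall>f. f \<notin> smooth_functions M \<longrightarrow> D f = 0)}"

text \<open>The differential does not mention the base point: a derivation \<open>D\<close> at \<open>p\<close> is sent to
  \<open>h \<mapsto> D (h \<circ> F)\<close>, a derivation at \<open>F p\<close>.\<close>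

definition differential ::
  "('a, 'e::euclidean_space) mfd \<Rightarrow> ('b, 'f::euclidean_space) mfd \<Rightarrow> ('a \<Rightarrow> 'b) \<Rightarrow> 'a tvec \<Rightarrow> 'b tvec"
  where
  "differential M N F D =
     (\<lambda>h. if h \<in> smooth_functions N then D (\<lambda>x. if x \<in> points M then h (F x) else 0) else 0)"

text \<open>Submanifolds are immersed ones: a subset with a manifold structure of its own whose inclusion
  is an immersion. Its topology may be finer than the subspace topology.\<close>

definition submanifold :: "('a, 'p::euclidean_space) mfd \<Rightarrow> ('a, 'm::euclidean_space) mfd \<Rightarrow> bool" where
  "submanifold Mb M \<longleftrightarrow> smooth_manifold Mb \<and> smooth_manifold M \<and> points M \<subseteq> points Mb \<and>
     smooth_map M Mb (\<lambda>x. x) \<and>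
     (\<forall>x \<in> points M. inj_on (differential M Mb (\<lambda>x. x)) (tangent_space M x))"

text \<open>\<open>T\<^sub>xM\<close> is identified with its image in the tangent space of the ambient manifold.\<close>

definition sub_tangent ::
  "('a, 'p::euclidean_space) mfd \<Rightarrow> ('a, 'm::euclidean_space) mfd \<Rightarrow> 'a \<Rightarrow> 'a tvec set" where
  "sub_tangent Mb M x = differential M Mb (\<lambda>x. x) ` tangent_space M x"

text \<open>Smooth sections over \<open>W\<close>, open in \<open>M\<close>, of the restriction of the ambient tangent bundle
  to \<open>M\<close>, with values in a family \<open>E\<close> of subspaces. Taking \<open>M\<close> to be \<open>Mb\<close> gives vector fields
  on open subsets of \<open>Mb\<close>.\<close>

definition smooth_section ::
  "('a, 'p::euclidean_space) mfd \<Rightarrow> ('a, 'm::euclidean_space) mfd \<Rightarrow> 'a set \<Rightarrow>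
     ('a \<Rightarrow> 'a tvec set) \<Rightarrow> ('a \<Rightarrow> 'a tvec) \<Rightarrow> bool" where
  "smooth_section Mb M W E X \<longleftrightarrow> openin (mtop M) W \<and>
     (\<forall>x \<in> W. X x \<in> tangent_space Mb x \<and> X x \<in> E x) \<and>
     (\<forall>f \<in> smooth_functions Mb. smooth_fun_on M W (\<lambda>x. X x f))"

definition local_frame ::
  "('a, 'p::euclidean_space) mfd \<Rightarrow> ('a, 'm::euclidean_space) mfd \<Rightarrow> 'a set \<Rightarrow>
     ('a \<Rightarrow> 'a tvec set) \<Rightarrow> nat \<Rightarrow> (nat \<Rightarrow> 'a \<Rightarrow> 'a tvec) \<Rightarrow> bool" where
  "local_frame Mb M W E r \<xi> \<longleftrightarrow>
     (\<forall>i \<in> {1..r}. smooth_section Mb M W E (\<xi> i)) \<and>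
     (\<forall>x \<in> W. inj_on (\<lambda>i. \<xi> i x) {1..r} \<and> independent ((\<lambda>i. \<xi> i x) ` {1..r}) \<and>
        span ((\<lambda>i. \<xi> i x) ` {1..r}) = E x)"

text \<open>Smooth distributions of constant rank on \<open>M\<close>: every point has an open neighbourhood with a
  smooth local frame.\<close>

definition smooth_distribution ::
  "('a, 'p::euclidean_space) mfd \<Rightarrow> ('a, 'm::euclidean_space) mfd \<Rightarrow>
     ('a \<Rightarrow> 'a tvec set) \<Rightarrow> nat \<Rightarrow> bool" where
  "smooth_distribution Mb M E r \<longleftrightarrow>
     (\<forall>x \<in> points M. subspace (E x) \<and> E x \<subseteq> sub_tangent Mb M x) \<and>
     (\<forall>x \<in> points M. \<exists>W \<xi>. openin (mtop M) W \<and> x \<in> W \<and> local_frame Mb M W E r \<xi>)"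

section \<open>Semi-Riemannian metrics\<close>

definition symmetric_bilinear_on ::
  "'v::real_vector set \<Rightarrow> ('v \<Rightarrow> 'v \<Rightarrow> real) \<Rightarrow> bool" where
  "symmetric_bilinear_on V b \<longleftrightarrow>
     (\<forall>u \<in> V. \<forall>v \<in> V. b u v = b v u) \<and>
     (\<forall>u \<in> V. \<forall>v \<in> V. \<forall>w \<in> V. b (u + v) w = b u w + b v w) \<and>
     (\<forall>c. \<forall>u \<in> V. \<forall>w \<in> V. b (c *\<^sub>R u) w = c * b u w)"

definition nondegenerate_on ::
  "'v::real_vector set \<Rightarrow> ('v \<Rightarrow> 'v \<Rightarrow> real) \<Rightarrow> bool" where
  "nondegenerate_on V b \<longleftrightarrow> (\<forall>u \<in> V. (\<forall>v \<in> V. b u v = 0) \<longrightarrow> u = 0)"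

definition form_index :: "'v::real_vector set \<Rightarrow> ('v \<Rightarrow> 'v \<Rightarrow> real) \<Rightarrow> nat" where
  "form_index V b = Max {dim W | W. subspace W \<and> W \<subseteq> V \<and> (\<forall>w \<in> W. w \<noteq> 0 \<longrightarrow> b w w < 0)}"

type_synonym 'a tform = "'a \<Rightarrow> 'a tvec \<Rightarrow> 'a tvec \<Rightarrow> real"

text \<open>A metric of constant index \<open>q\<close>.\<close>

definition semi_riemannian :: "('a, 'p::euclidean_space) mfd \<Rightarrow> 'a tform \<Rightarrow> nat \<Rightarrow> bool" where
  "semi_riemannian Mb gb q \<longleftrightarrow> smooth_manifold Mb \<and>
     (\<forall>x \<in> points Mb. symmetric_bilinear_on (tangent_space Mb x) (gb x) \<and>
        nondegenerate_on (tangent_space Mb x) (gb x) \<and>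
        form_index (tangent_space Mb x) (gb x) = q) \<and>
     (\<forall>W X Y. smooth_section Mb Mb W (tangent_space Mb) X \<and>
        smooth_section Mb Mb W (tangent_space Mb) Y \<longrightarrow>
        smooth_fun_on Mb W (\<lambda>x. gb x (X x) (Y x)))"

definition orthogonal_in ::
  "('a, 'p::euclidean_space) mfd \<Rightarrow> 'a tform \<Rightarrow> ('a \<Rightarrow> 'a tvec set) \<Rightarrow> 'a \<Rightarrow> 'a tvec set" where
  "orthogonal_in Mb gb E x = {v \<in> tangent_space Mb x. \<forall>u \<in> E x. gb x v u = 0}"

definition induced_form ::
  "('a, 'p::euclidean_space) mfd \<Rightarrow> 'a tform \<Rightarrow> ('a, 'm::euclidean_space) mfd \<Rightarrow> 'a tform" where
  "induced_form Mb gb M x u v =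
     (if u \<in> sub_tangent Mb M x \<and> v \<in> sub_tangent Mb M x then gb x u v else 0)"

section \<open>Null submanifolds\<close>

definition radical_distribution ::
  "('a, 'p::euclidean_space) mfd \<Rightarrow> 'a tform \<Rightarrow> ('a, 'm::euclidean_space) mfd \<Rightarrow> 'a \<Rightarrow> 'a tvec set"
  where
  "radical_distribution Mb gb M x = sub_tangent Mb M x \<inter> orthogonal_in Mb gb (sub_tangent Mb M) x"

definition null_submanifold ::
  "('a, 'p::euclidean_space) mfd \<Rightarrow> 'a tform \<Rightarrow> ('a, 'm::euclidean_space) mfd \<Rightarrow> nat \<Rightarrow> bool" where
  "null_submanifold Mb gb M r \<longleftrightarrow>
     submanifold Mb M \<and> 0 < r \<and> smooth_distribution Mb M (radical_distribution Mb gb M) r"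

text \<open>\<open>r = k < n\<close>, where \<open>n\<close> is the dimension and \<open>k\<close> the codimension of \<open>M\<close>.\<close>

definition coisotropic ::
  "('a, 'p::euclidean_space) mfd \<Rightarrow> 'a tform \<Rightarrow> ('a, 'm::euclidean_space) mfd \<Rightarrow> nat \<Rightarrow> bool" where
  "coisotropic Mb gb M r \<longleftrightarrow>
     null_submanifold Mb gb M r \<and> DIM('p) = DIM('m) + r \<and> r < DIM('m)"

definition screen_distribution ::
  "('a, 'p::euclidean_space) mfd \<Rightarrow> 'a tform \<Rightarrow> ('a, 'm::euclidean_space) mfd \<Rightarrow> nat \<Rightarrow>
     ('a \<Rightarrow> 'a tvec set) \<Rightarrow> bool" where
  "screen_distribution Mb gb M r S \<longleftrightarrow>
     smooth_distribution Mb M S (DIM('m) - r) \<and>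
     (\<forall>x \<in> points M. S x \<inter> radical_distribution Mb gb M x = {0} \<and>
        {u + v | u v. u \<in> S x \<and> v \<in> radical_distribution Mb gb M x} = sub_tangent Mb M x)"

definition null_transversal_sections ::
  "('a, 'p::euclidean_space) mfd \<Rightarrow> 'a tform \<Rightarrow> ('a, 'm::euclidean_space) mfd \<Rightarrow> nat \<Rightarrow>
     ('a \<Rightarrow> 'a tvec set) \<Rightarrow> 'a set \<Rightarrow> (nat \<Rightarrow> 'a \<Rightarrow> 'a tvec) \<Rightarrow> (nat \<Rightarrow> 'a \<Rightarrow> 'a tvec) \<Rightarrow> bool" where
  "null_transversal_sections Mb gb M r S U \<xi> N \<longleftrightarrow>
     (\<forall>i \<in> {1..r}. smooth_section Mb M U (orthogonal_in Mb gb S) (N i)) \<and>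
     (\<forall>x \<in> U. \<forall>i \<in> {1..r}. \<forall>j \<in> {1..r}.
        gb x (N i x) (\<xi> j x) = (if i = j then 1 else 0) \<and> gb x (N i x) (N j x) = 0)"

definition omega :: "'a tform \<Rightarrow> (nat \<Rightarrow> 'a \<Rightarrow> 'a tvec) \<Rightarrow> nat \<Rightarrow> 'a \<Rightarrow> 'a tvec \<Rightarrow> real" where
  "omega gb N i x X = gb x X (N i x)"

definition g_tilde ::
  "('a, 'p::euclidean_space) mfd \<Rightarrow> 'a tform \<Rightarrow> ('a, 'm::euclidean_space) mfd \<Rightarrow> nat \<Rightarrow>
     (nat \<Rightarrow> 'a \<Rightarrow> 'a tvec) \<Rightarrow> 'a tform" where
  "g_tilde Mb gb M r N x X Y =
     induced_form Mb gb M x X Y - (\<Sum>i = 1..r. omega gb N i x X * omega gb N i x Y)"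

end

theory Submission
  imports Defs
begin

text \<open>At a point of \<open>U\<close> the claim is linear algebra on \<open>V = T\<^sub>xM\<close>. The forms \<open>\<omega>\<^sub>i\<close> restricted to
  the radical of \<open>g\<close> are the coordinates with respect to the frame \<open>\<xi>\<^sub>j\<close>, because
  \<open>\<omega>\<^sub>i(\<xi>\<^sub>j) = \<delta>\<^sub>i\<^sub>j\<close>. Suppose that \<open>u \<in> V\<close> satisfies \<open>g(u, v) = \<Sum>\<^sub>i \<omega>\<^sub>i(u) \<omega>\<^sub>i(v)\<close> for all
  \<open>v \<in> V\<close>. Taking \<open>v = \<xi>\<^sub>j\<close>, where the left side vanishes, gives \<open>\<omega>\<^sub>j(u) = 0\<close> for every \<open>j\<close>.
  Hence \<open>g(u, v) = 0\<close> for all \<open>v \<in> V\<close>, so \<open>u\<close> lies in the radical; as all its coordinates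
  \<open>\<omega>\<^sub>j(u)\<close> are zero, \<open>u = 0\<close>. Thus the correction, which
  makes the form negative definite on the radical, creates no new degenerate directions; this is
  \<open>nondegenerate_on_minus_dual_squares\<close>.

  To apply it, \<open>V\<close> has to be a linear subspace of the ambient tangent space, where the metric is
  bilinear. The screen gives this: \<open>V\<close> is the sum of the screen and the radical, and both of them
  are spanned by ambient tangent vectors (\<open>sub_tangent_of_screen\<close>).\<close>

section \<open>Symmetric forms corrected by squares of functionals\<close>

lemma dual_frame_expansion:
  fixes \<xi> :: "'i \<Rightarrow> 'v::real_vector"
  assumes "finite I" and V: "subspace V" and \<xi>: "\<And>i. i \<in> I \<Longrightarrow> \<xi> i \<in> V"
    and add: "\<And>i u v. i \<in> I \<Longrightarrow> u \<in> V \<Longrightarrow> v \<in> V \<Longrightarrow> \<omega> i (u + v) = \<omega> i u + \<omega> i v"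
    and scale: "\<And>i c u. i \<in> I \<Longrightarrow> u \<in> V \<Longrightarrow> \<omega> i (c *\<^sub>R u) = c * (\<omega> i u :: real)"
    and dual: "\<And>i j. i \<in> I \<Longrightarrow> j \<in> I \<Longrightarrow> \<omega> i (\<xi> j) = (if i = j then 1 else 0)"
    and u: "u \<in> span (\<xi> ` I)"
  shows "u = (\<Sum>i\<in>I. \<omega> i u *\<^sub>R \<xi> i)"
proof -
  let ?E = "{u \<in> V. u = (\<Sum>i\<in>I. \<omega> i u *\<^sub>R \<xi> i)}"
  have zero: "\<omega> i 0 = 0" if "i \<in> I" for i
    using scale[of i 0 0] that subspace_0[OF V] by simp
  have "subspace ?E"
  proof (rule subspaceI)
    show "0 \<in> ?E"
      using subspace_0[OF V] by (simp add: zero)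
  next
    fix u v assume u: "u \<in> ?E" and v: "v \<in> ?E"
    have "(\<Sum>i\<in>I. \<omega> i (u + v) *\<^sub>R \<xi> i) = (\<Sum>i\<in>I. \<omega> i u *\<^sub>R \<xi> i) + (\<Sum>i\<in>I. \<omega> i v *\<^sub>R \<xi> i)"
      using u v by (simp add: add scaleR_add_left sum.distrib)
    then show "u + v \<in> ?E"
      using u v subspace_add[OF V] by auto
  next
    fix c u assume u: "u \<in> ?E"
    have "(\<Sum>i\<in>I. \<omega> i (c *\<^sub>R u) *\<^sub>R \<xi> i) = c *\<^sub>R (\<Sum>i\<in>I. \<omega> i u *\<^sub>R \<xi> i)"
    proof -
      have "u \<in> V"
        using u by simp
      then show ?thesis
        by (simp add: scale scaleR_sum_right)
    qed
    then show "c *\<^sub>R u \<in> ?E"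
      using u subspace_scale[OF V] by auto
  qed
  moreover have "\<xi> ` I \<subseteq> ?E"
  proof clarify
    fix j assume j: "j \<in> I"
    have "(\<Sum>i\<in>I. \<omega> i (\<xi> j) *\<^sub>R \<xi> i) = (\<Sum>i\<in>I. if i = j then \<xi> i else 0)"
      using j by (intro sum.cong) (auto simp: dual)
    also have "\<dots> = \<xi> j"
      using j \<open>finite I\<close> by simp
    finally show "\<xi> j \<in> V \<and> \<xi> j = (\<Sum>i\<in>I. \<omega> i (\<xi> j) *\<^sub>R \<xi> i)"
      using j \<xi> by simp
  qed
  ultimately have "span (\<xi> ` I) \<subseteq> ?E"
    by (rule span_minimal[rotated])
  with u show ?thesis by blast
qed

text \<open>A degenerate vector \<open>u\<close> is first paired with each radical vector \<open>\<xi> j\<close>: there \<open>b\<close> vanishes and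
  the correction picks out \<open>\<omega> j u\<close>. This puts \<open>u\<close> itself into the radical, where the
  \<open>\<omega> j\<close> are coordinates.\<close>

lemma nondegenerate_on_minus_dual_squares:
  fixes b :: "'v::real_vector \<Rightarrow> 'v \<Rightarrow> real"
  assumes "finite I" and V: "subspace V"
    and add: "\<And>i u v. i \<in> I \<Longrightarrow> u \<in> V \<Longrightarrow> v \<in> V \<Longrightarrow> \<omega> i (u + v) = \<omega> i u + \<omega> i v"
    and scale: "\<And>i c u. i \<in> I \<Longrightarrow> u \<in> V \<Longrightarrow> \<omega> i (c *\<^sub>R u) = c * \<omega> i u"
    and dual: "\<And>i j. i \<in> I \<Longrightarrow> j \<in> I \<Longrightarrow> \<omega> i (\<xi> j) = (if i = j then 1 else 0)"
    and \<xi>: "\<And>i. i \<in> I \<Longrightarrow> \<xi> i \<in> V"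
    and \<xi>_rad: "\<And>i u. i \<in> I \<Longrightarrow> u \<in> V \<Longrightarrow> b u (\<xi> i) = 0"
    and rad: "\<And>u. u \<in> V \<Longrightarrow> (\<forall>v\<in>V. b u v = 0) \<Longrightarrow> u \<in> span (\<xi> ` I)"
  shows "nondegenerate_on V (\<lambda>u v. b u v - (\<Sum>i\<in>I. \<omega> i u * \<omega> i v))"
  unfolding nondegenerate_on_def
proof (intro ballI impI)
  fix u assume u: "u \<in> V" and null: "\<forall>v\<in>V. b u v - (\<Sum>i\<in>I. \<omega> i u * \<omega> i v) = 0"
  have coord: "\<omega> j u = 0" if j: "j \<in> I" for j
  proof -
    have "(\<Sum>i\<in>I. \<omega> i u * \<omega> i (\<xi> j)) = (\<Sum>i\<in>I. if i = j then \<omega> i u else 0)"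
      using j by (intro sum.cong) (auto simp: dual)
    then show ?thesis
      using null \<xi>[OF j] \<xi>_rad[OF j u] j \<open>finite I\<close> by force
  qed
  then have "\<forall>v\<in>V. b u v = 0"
    using null by simp
  then have "u \<in> span (\<xi> ` I)"
    using rad u by blast
  then have "u = (\<Sum>i\<in>I. \<omega> i u *\<^sub>R \<xi> i)"
    by (intro dual_frame_expansion[OF \<open>finite I\<close> V \<xi> add scale dual])
  also have "\<dots> = 0"
    using coord by simp
  finally show "u = 0" .
qed

lemma symmetric_bilinear_on_minus_squares:
  fixes b :: "'v::real_vector \<Rightarrow> 'v \<Rightarrow> real"
  assumes "symmetric_bilinear_on V b"
    and "\<And>i u v. i \<in> I \<Longrightarrow> u \<in> V \<Longrightarrow> v \<in> V \<Longrightarrow> \<omega> i (u + v) = \<omega> i u + \<omega> i v"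
    and "\<And>i c u. i \<in> I \<Longrightarrow> u \<in> V \<Longrightarrow> \<omega> i (c *\<^sub>R u) = c * \<omega> i u"
  shows "symmetric_bilinear_on V (\<lambda>u v. b u v - (\<Sum>i\<in>I. \<omega> i u * \<omega> i v))"
proof -
  let ?q = "\<lambda>u v. \<Sum>i\<in>I. \<omega> i u * \<omega> i v"
  have "?q u v = ?q v u" for u v
    by (simp add: mult.commute)
  moreover have "?q (u + v) w = ?q u w + ?q v w" if "u \<in> V" "v \<in> V" for u v w
    using that assms(2) by (simp add: distrib_right sum.distrib)
  moreover have "?q (c *\<^sub>R u) w = c * ?q u w" if "u \<in> V" for c u w
    using that assms(3) by (simp add: sum_distrib_left mult.assoc)
  ultimately show ?thesis
    using assms(1) unfolding symmetric_bilinear_on_def by (simp add: right_diff_distrib)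
qed

section \<open>The tangent space of the submanifold inside the ambient one\<close>

lemma subspace_tangent_space: "subspace (tangent_space Mb x)"
proof (rule subspaceI)
  show "0 \<in> tangent_space Mb x"
    unfolding tangent_space_def by simp
next
  fix D E assume "D \<in> tangent_space Mb x" and "E \<in> tangent_space Mb x"
  then show "D + E \<in> tangent_space Mb x"
    unfolding tangent_space_def by (simp add: distrib_left)
next
  fix c D assume "D \<in> tangent_space Mb x"
  then show "c *\<^sub>R D \<in> tangent_space Mb x"
    unfolding tangent_space_def by (simp add: scaleR_fun_def distrib_left mult.left_commute)
qed

lemma smooth_distribution_subset_tangent_space:
  assumes "smooth_distribution Mb M E r" and "x \<in> points M"
  shows "E x \<subseteq> tangent_space Mb x"
proof -
  obtain W \<xi> where "x \<in> W" and frame: "local_frame Mb M W E r \<xi>"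
    using assms unfolding smooth_distribution_def by blast
  then have "(\<lambda>i. \<xi> i x) ` {1..r} \<subseteq> tangent_space Mb x"
    and "span ((\<lambda>i. \<xi> i x) ` {1..r}) = E x"
    unfolding local_frame_def smooth_section_def by auto
  then show ?thesis
    using span_minimal subspace_tangent_space by metis
qed

text \<open>Reading the tangent space of \<open>M\<close> off the decomposition into screen and radical, whose frames
  consist of ambient tangent vectors, avoids differentiating the inclusion.\<close>

lemma sub_tangent_of_screen:
  fixes M :: "('a, 'm::euclidean_space) mfd"
  assumes null: "null_submanifold Mb gb M r"
    and screen: "screen_distribution Mb gb M r S" and x: "x \<in> points M"
  shows "subspace (sub_tangent Mb M x)" and "sub_tangent Mb M x \<subseteq> tangent_space Mb x"
proof -
  let ?R = "radical_distribution Mb gb M"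
  have S: "smooth_distribution Mb M S (DIM('m) - r)" and R: "smooth_distribution Mb M ?R r"
    using null screen unfolding null_submanifold_def screen_distribution_def by auto
  have sum: "sub_tangent Mb M x = {u + v | u v. u \<in> S x \<and> v \<in> ?R x}"
    using screen x unfolding screen_distribution_def by auto
  have "subspace (S x)" and "subspace (?R x)"
    using S R x unfolding smooth_distribution_def by auto
  then show "subspace (sub_tangent Mb M x)"
    unfolding sum by (rule subspace_sums)
  show "sub_tangent Mb M x \<subseteq> tangent_space Mb x"
  proof
    fix w assume "w \<in> sub_tangent Mb M x"
    then obtain u v where w: "w = u + v" and "u \<in> S x" and "v \<in> ?R x"
      unfolding sum by blast
    then have "u \<in> tangent_space Mb x" and "v \<in> tangent_space Mb x"
      using smooth_distribution_subset_tangent_space[OF S x]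
        smooth_distribution_subset_tangent_space[OF R x] by auto
    then show "w \<in> tangent_space Mb x"
      unfolding w by (rule subspace_add[OF subspace_tangent_space])
  qed
qed

section \<open>Nondegeneracy of the corrected metric\<close>

theorem lemma3p1:
  fixes Mb :: "('a, 'p::euclidean_space) mfd" and gb :: "'a tform"
    and M :: "('a, 'm::euclidean_space) mfd"
    and n k r q :: nat
    and S :: "'a \<Rightarrow> 'a tvec set" and U :: "'a set"
    and \<xi> N :: "nat \<Rightarrow> 'a \<Rightarrow> 'a tvec"
  assumes "DIM('m) = n" and "DIM('p) = n + k" and "n > 1" and "k \<ge> 1"
    and "q \<in> {1..n + k - 1}"
    and "semi_riemannian Mb gb q"
    and "coisotropic Mb gb M r"
    and "screen_distribution Mb gb M r S"
    and "openin (mtop M) U"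
    and "local_frame Mb M U (radical_distribution Mb gb M) r \<xi>"
    and "null_transversal_sections Mb gb M r S U \<xi> N"
  shows "\<forall>x \<in> U. symmetric_bilinear_on (sub_tangent Mb M x) (g_tilde Mb gb M r N x) \<and>
           nondegenerate_on (sub_tangent Mb M x) (g_tilde Mb gb M r N x)"
proof
  fix x assume xU: "x \<in> U"
  let ?T = "tangent_space Mb x" and ?V = "sub_tangent Mb M x"
  let ?R = "radical_distribution Mb gb M x" and ?g = "induced_form Mb gb M x"
  let ?\<omega> = "\<lambda>i. omega gb N i x" and ?\<xi> = "\<lambda>i. \<xi> i x"
  have x: "x \<in> points M"
    using xU assms(9) openin_subset by blast
  have null: "null_submanifold Mb gb M r"
    using assms(7) unfolding coisotropic_def by simp
  have V: "subspace ?V" and VT: "?V \<subseteq> ?T"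
    using sub_tangent_of_screen[OF null assms(8) x] by auto
  have "x \<in> points Mb"
    using null x unfolding null_submanifold_def submanifold_def by auto
  then have gb: "symmetric_bilinear_on ?T (gb x)"
    using assms(6) unfolding semi_riemannian_def by simp
  then have comm: "gb x u v = gb x v u" if "u \<in> ?T" "v \<in> ?T" for u v
    using that unfolding symmetric_bilinear_on_def by blast

  have \<xi>: "?\<xi> i \<in> ?V" and \<xi>R: "?\<xi> i \<in> ?R" if "i \<in> {1..r}" for i
    using assms(10) xU that
    unfolding local_frame_def smooth_section_def radical_distribution_def by auto
  have span: "span (?\<xi> ` {1..r}) = ?R"
    using assms(10) xU unfolding local_frame_def by auto
  have N: "N i x \<in> ?T" if "i \<in> {1..r}" for i
    using assms(11) xU that unfolding null_transversal_sections_def smooth_section_def by auto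

  have add: "?\<omega> i (u + v) = ?\<omega> i u + ?\<omega> i v" if "i \<in> {1..r}" "u \<in> ?V" "v \<in> ?V" for i u v
    using gb N[OF that(1)] that(2,3) VT unfolding symmetric_bilinear_on_def omega_def by blast
  have scale: "?\<omega> i (c *\<^sub>R u) = c * ?\<omega> i u" if "i \<in> {1..r}" "u \<in> ?V" for i c u
    using gb N[OF that(1)] that(2) VT unfolding symmetric_bilinear_on_def omega_def by blast
  have dual: "?\<omega> i (?\<xi> j) = (if i = j then 1 else 0)" if "i \<in> {1..r}" "j \<in> {1..r}" for i j
    using assms(11) xU that comm[of "?\<xi> j" "N i x"] N[of i] \<xi>[of j] VT
    unfolding null_transversal_sections_def omega_def by auto

  have g: "symmetric_bilinear_on ?V ?g"
  proof -
    have "gb x u v = gb x v u" if "u \<in> ?V" "v \<in> ?V" for u v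
      using comm that VT by blast
    moreover have "gb x (u + v) w = gb x u w + gb x v w"
      if "u \<in> ?V" "v \<in> ?V" "w \<in> ?V" for u v w
      using gb that VT unfolding symmetric_bilinear_on_def by blast
    moreover have "gb x (c *\<^sub>R u) w = c * gb x u w" if "u \<in> ?V" "w \<in> ?V" for c u w
      using gb that VT unfolding symmetric_bilinear_on_def by blast
    ultimately show ?thesis
      unfolding symmetric_bilinear_on_def induced_form_def
      using subspace_add[OF V] subspace_scale[OF V] by (intro conjI ballI allI) simp_all
  qed
  have g_\<xi>: "?g u (?\<xi> i) = 0" if "i \<in> {1..r}" "u \<in> ?V" for i u
    using \<xi>R[OF that(1)] that(2) comm[of u "?\<xi> i"] VT
    unfolding radical_distribution_def orthogonal_in_def induced_form_def by auto
  have g_rad: "u \<in> span (?\<xi> ` {1..r})" if "u \<in> ?V" "\<forall>v\<in>?V. ?g u v = 0" for u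
    using that VT unfolding span radical_distribution_def orthogonal_in_def induced_form_def
    by auto

  have g_tilde: "g_tilde Mb gb M r N x = (\<lambda>u v. ?g u v - (\<Sum>i\<in>{1..r}. ?\<omega> i u * ?\<omega> i v))"
    by (intro ext) (simp add: g_tilde_def)
  show "symmetric_bilinear_on ?V (g_tilde Mb gb M r N x) \<and>
      nondegenerate_on ?V (g_tilde Mb gb M r N x)"
    unfolding g_tilde
  proof
    show "symmetric_bilinear_on ?V (\<lambda>u v. ?g u v - (\<Sum>i\<in>{1..r}. ?\<omega> i u * ?\<omega> i v))"
      by (rule symmetric_bilinear_on_minus_squares[where \<omega> = ?\<omega>, OF g add scale])
    show "nondegenerate_on ?V (\<lambda>u v. ?g u v - (\<Sum>i\<in>{1..r}. ?\<omega> i u * ?\<omega> i v))"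
      by (rule nondegenerate_on_minus_dual_squares[where b = ?g and \<omega> = ?\<omega> and \<xi> = ?\<xi>,
            OF finite_atLeastAtMost V add scale dual \<xi> g_\<xi> g_rad])
  qed
qed

end
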